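(* Let $d$ be a Dyck number and let $r$ be the length of the repunit suffix in the binary expansion of $d$. Then: 1. if $r = 0$, then $DS(d) = 1$; 2. if $r = 1$ or $r = 2$, then $DS(d) = d + 2$; 3. otherwise (i.e. $r \ge 3$), $DS(d) = d + 2^{\,r-1-\lfloor h/2 \rfloor}$, where $h$ is the valley depth (height of the deepest valley) of the binary string obtained from the binary expansion of $d$ by swapping the rightmost digit $0$ with the digit $1$ immediately to its right (the highest digit of the repunit suffix).
   Context: A Dyck number is a natural number in whose binary expansion (written without leading zeros) every suffix (final fragment, i.e. block of least significant digits) contains at most as many digits $0$ as digits $1$. By convention $0$ is also a Dyck number (its repunit suffix has length $0$). In increasing order the Dyck numbers are $0, 1, 3, 5, 7, 11, 13, 15, 19, 21, 23, 27, 29, 31, 39, \dots$ (OEIS A036991). The Dyck successor function $DS$ sends a Dyck number $d$ to the next one, i.e. $DS(d)$ is the smallest Dyck number strictly greater than $d$. The repunit suffix of $d$ is the maximal block of consecutive digits $1$ at the right (least significant) end of its binary expansion; $r$ is its length. For a binary string, the height of a digit is the number of $1$'s minus the number of $0$'s in the suffix that begins at that digit (the digit itself included) and extends to the right end of the string; so a rightmost digit $1$ has height $1$. A valley is a digit $0$ whose immediate left neighbour is a digit $1$, and the height of the valley is the height of that digit $0$. The valley depth of a string is the smallest height of a valley in it. If $d = 2^n - 1$ is a Mersenne number (its binary expansion consists only of $1$'s, so $r = n$), one leading zero is inserted at the beginning of the binary expansion before the swap, so that the swap turns $0\,1^r$ into $1\,0\,1^{r-1}$. In all other cases with $r\ge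 1$ the swap replaces the ending $0\,1^r$ of the binary expansion by $1\,0\,1^{r-1}$. *)

theory Defs
  imports Complex_Main "HOL-Library.Sublist"
begin

text \<open>Binary strings are lists of the digits \<open>0\<close> and \<open>1\<close>, most significant digit first,
  so that a final fragment of the string is a list suffix.\<close>

text \<open>No leading zeros; in particular the expansion of \<open>0\<close> is the empty string.\<close>

fun binary :: "nat \<Rightarrow> nat list" where
  "binary n = (if n = 0 then [] else binary (n div 2) @ [n mod 2])"

declare binary.simps [simp del]

definition dyck :: "nat \<Rightarrow> bool" where
  "dyck d \<longleftrightarrow> d = 0 \<or> (\<forall>s. suffix s (binary d) \<longrightarrow> count_list s 0 \<le> count_list s 1)"

definition DS :: "nat \<Rightarrow> nat" where
  "DS d = (LEAST e. dyck e \<and> d < e)"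

definition repunit_length :: "nat \<Rightarrow> nat" where
  "repunit_length d = length (takeWhile (\<lambda>b. b = 1) (rev (binary d)))"

text \<open>Positions in a string are list indices, i.e. counted from the left, starting at \<open>0\<close>.\<close>

definition height :: "nat list \<Rightarrow> nat \<Rightarrow> int" where
  "height w i = int (count_list (drop i w) 1) - int (count_list (drop i w) 0)"

definition valley :: "nat list \<Rightarrow> nat \<Rightarrow> bool" where
  "valley w i \<longleftrightarrow> 0 < i \<and> i < length w \<and> w ! i = 0 \<and> w ! (i - 1) = 1"

text \<open>Only meaningful for strings that contain a valley.\<close>

definition valley_depth :: "nat list \<Rightarrow> int" where
  "valley_depth w = Min {height w i | i. valley w i}"

definition mersenne :: "nat \<Rightarrow> bool" where
  "mersenne d \<longleftrightarrow> (\<exists>n. d = 2 ^ n - 1)"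

definition padded_binary :: "nat \<Rightarrow> nat list" where
  "padded_binary d = (if mersenne d then 0 # binary d else binary d)"

definition rightmost_zero :: "nat list \<Rightarrow> nat" where
  "rightmost_zero w = Max {i. i < length w \<and> w ! i = 0}"

text \<open>Only meaningful if the string contains a \<open>0\<close> and ends in \<open>1\<close>; the digit immediately to
  the right of the rightmost \<open>0\<close> then exists and is a \<open>1\<close>.\<close>

definition swap_rightmost_zero :: "nat list \<Rightarrow> nat list" where
  "swap_rightmost_zero w =
    (let i = rightmost_zero w in w[i := w ! (i + 1), i + 1 := w ! i])"

end

theory Submission
  imports Defs
begin

text \<open>
  Write \<open>d + 1 = 2 ^ r * (2 * a + 1)\<close> and \<open>A = binary a\<close>, so that \<open>d\<close> reads \<open>A 0 1\<^sup>r\<close> and the numbers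
  directly above \<open>d\<close> read \<open>A 1 B\<close> with \<open>B\<close> of length \<open>r\<close>. With \<open>A 1 0 1\<^bsup>r-1\<^esup>\<close> as the reference string,
  whose lowest suffix height over its first \<open>|A| + 2\<close> positions is the valley depth \<open>h\<close>, the
  string \<open>A 1 0\<^bsup>k+1\<^esup> 1\<^bsup>r-1-k\<^esup>\<close> has these heights lowered by \<open>2 * k\<close>. They stay nonnegative
  for \<open>k = h div 2\<close>, whereas any smaller number above \<open>d\<close> has one more \<open>0\<close> in \<open>B\<close>, which lowers the
  deepest valley by at least another \<open>2\<close>, below zero.
\<close>

section \<open>Fixed-width binary expansions\<close>

text \<open>Keeps leading zeros, unlike \<open>binary\<close>: the block \<open>B\<close> may begin
  with zeros.\<close>

primrec bits :: "nat \<Rightarrow> nat \<Rightarrow> nat list" where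
  "bits 0 n = []"
| "bits (Suc m) n = bits m (n div 2) @ [n mod 2]"

lemma bits_add: "bits (p + q) n = bits p (n div 2 ^ q) @ bits q n"
  by (induction q arbitrary: n) (simp_all add: div_mult2_eq)

lemma bits_mult_add: "bits m (c * 2 ^ m + b) = bits m b"
proof (induction m arbitrary: b)
  case (Suc m)
  define x where "x = c * 2 ^ m"
  have "c * 2 ^ Suc m + b = 2 * x + b" by (simp add: x_def)
  moreover have "(2 * x + b) div 2 = x + b div 2" "(2 * x + b) mod 2 = b mod 2" by simp_all
  ultimately show ?case using Suc x_def by (simp only: bits.simps)
qed simp

lemma bits_zero: "bits m 0 = replicate m 0"
  by (induction m) (simp_all add: replicate_append_same)

lemma bits_repunit: "bits m (x * 2 ^ m + (2 ^ m - 1)) = replicate m 1"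
proof (induction m)
  case (Suc m)
  obtain p where "2 ^ m = Suc p" by (metis not0_implies_Suc power_not_zero zero_neq_numeral)
  then have "x * 2 ^ Suc m + (2 ^ Suc m - 1) = 2 * (x * 2 ^ m + (2 ^ m - 1)) + (1::nat)"
    by simp
  then show ?case using Suc by (simp add: replicate_append_same)
qed simp

lemma binary_0 [simp]: "binary 0 = []"
  by (simp add: binary.simps)

lemma binary_pos: "n > 0 \<Longrightarrow> binary n = binary (n div 2) @ [n mod 2]"
  by (subst binary.simps) simp

lemma binary_double_add_one: "binary (2 * a + 1) = binary a @ [1]"
  using binary_pos[of "2 * a + 1"] by simp

lemma binary_append_bits:
  "n div 2 ^ m > 0 \<Longrightarrow> binary n = binary (n div 2 ^ m) @ bits m n"
proof (induction m arbitrary: n)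
  case (Suc m)
  then have "n > 0" by (metis div_0 gr0I less_irrefl)
  then show ?case
    using Suc.IH[of "n div 2"] Suc.prems by (simp add: binary_pos[of n] div_mult2_eq)
qed simp

lemma hd_binary: "n > 0 \<Longrightarrow> binary n ! 0 = 1 \<and> binary n \<noteq> []"
proof (induction n rule: less_induct)
  case (less n)
  show ?case
  proof (cases "n = 1")
    case False
    then show ?thesis
      using less by (simp add: binary_pos[of n] nth_append)
  qed (simp add: binary_pos)
qed

lemma set_binary: "set (binary n) \<subseteq> {0, 1}"
proof (induction n rule: less_induct)
  case (less n)
  then show ?case
    by (cases "n = 0") (auto simp: binary_pos[of n])
qed

text \<open>Trailing ones of \<open>d\<close> become trailing zeros of \<open>Suc d\<close>, so
  \<open>r\<close> is the 2-adic valuation of \<open>Suc d\<close>.\<close>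

lemma Suc_eq_repunit_length: "\<exists>a. Suc d = 2 ^ repunit_length d * (2 * a + 1)"
proof (induction d rule: less_induct)
  case (less d)
  show ?case
  proof (cases "even d")
    case True
    then have "repunit_length d = 0"
      by (cases "d = 0") (simp_all add: repunit_length_def binary_pos[of d])
    then show ?thesis using True by (auto elim!: evenE)
  next
    case False
    then have pos: "d > 0" and mod: "d mod 2 = 1" by (auto simp: odd_pos odd_iff_mod_2_eq_one)
    then have "repunit_length d = Suc (repunit_length (d div 2))"
      by (simp add: repunit_length_def binary_pos[of d])
    moreover obtain a where "Suc (d div 2) = 2 ^ repunit_length (d div 2) * (2 * a + 1)"
      using less pos by (meson div_less_dividend one_less_numeral_iff semiring_norm(76))
    moreover have "Suc d = 2 * Suc (d div 2)" using mod by presburger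
    ultimately show ?thesis by (intro exI[of _ a]) (simp only: power_Suc mult.assoc)
  qed
qed

section \<open>Heights\<close>

text \<open>Height of a whole string, free of positions and hence additive under
  concatenation.\<close>

definition balance :: "nat list \<Rightarrow> int" where
  "balance s = int (count_list s 1) - int (count_list s 0)"

lemma balance_Nil [simp]: "balance [] = 0"
  by (simp add: balance_def)

lemma balance_append [simp]: "balance (xs @ ys) = balance xs + balance ys"
  by (simp add: balance_def)

lemma balance_Cons: "balance (x # xs) = balance [x] + balance xs"
  using balance_append[of "[x]" xs] by simp

lemma balance_digit [simp]: "balance [0] = -1" "balance [Suc 0] = 1" "balance [1] = 1"
  by (simp_all add: balance_def)

lemma balance_replicate: "balance (replicate n x) = int n * balance [x]"
proof (induction n)
  case (Suc n)
  then show ?case by (simp add: balance_Cons[of x "replicate n x"] algebra_simps)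
qed simp

lemma balance_le_length: "balance xs \<le> int (length xs)"
  using count_le_length[of xs 1] by (simp add: balance_def)

lemma height_eq_balance: "height w i = balance (drop i w)"
  by (simp add: height_def balance_def)

lemma height_step: "i < length w \<Longrightarrow> height w i = balance [w ! i] + height w (Suc i)"
  by (metis height_eq_balance Cons_nth_drop_Suc balance_Cons)

lemma dyck_iff: "dyck d \<longleftrightarrow> (\<forall>i. 0 \<le> balance (drop i (binary d)))"
proof -
  have "(\<forall>s. suffix s (binary d) \<longrightarrow> count_list s 0 \<le> count_list s 1)
      \<longleftrightarrow> (\<forall>i. 0 \<le> balance (drop i (binary d)))"
    by (auto simp: balance_def suffix_drop) (metis suffix_def append_eq_conv_conj)
  then show ?thesis by (auto simp: dyck_def)
qed

lemma length_bits [simp]: "length (bits m n) = m"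
  by (induction m arbitrary: n) simp_all

text \<open>Below \<open>2 ^ m - 1\<close> the \<open>m\<close> digits are not all ones, and each 0
  costs 2 against the maximal balance \<open>m\<close>.\<close>

lemma balance_bits_le: "b < 2 ^ m - 1 \<Longrightarrow> balance (bits m b) \<le> int m - 2"
proof (induction m arbitrary: b)
  case (Suc m)
  show ?case
  proof (cases "b mod 2 = 0")
    case True
    then show ?thesis
      using balance_le_length[of "bits m (b div 2)"] by simp
  next
    case False
    then have odd: "b mod 2 = 1" by simp
    then have "b div 2 < 2 ^ m - 1" using Suc.prems by (simp add: less_diff_conv) presburger
    with Suc.IH[of "b div 2"] odd show ?thesis by simp
  qed
qed simp

lemma not_dyck_even:
  assumes "even n" "n > 0"
  shows "\<not> dyck n"
proof -
  have "binary n = binary (n div 2) @ [0]" using assms binary_pos[of n] by simp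
  then have "drop (length (binary (n div 2))) (binary n) = [0]" by simp
  then show ?thesis unfolding dyck_iff by (metis balance_digit(1) neg_0_le_iff_le not_one_le_zero)
qed

section \<open>Swapped strings and their valleys\<close>

text \<open>Mersenne numbers are the case \<open>a = 0\<close>: \<open>binary a\<close> is empty and
  the padding supplies the 0 of the common form.\<close>

lemma padded_binary_eq:
  assumes d: "Suc d = 2 ^ r * (2 * a + 1)"
  shows "padded_binary d = binary a @ 0 # replicate r 1"
    and "a > 0 \<Longrightarrow> binary d = binary a @ 0 # replicate r 1"
proof -
  have d': "d = (2 * a) * 2 ^ r + (2 ^ r - 1)"
    using d one_le_power[of "2::nat" r] by (simp add: algebra_simps)
  have dm: "d div 2 ^ r = 2 * a"
    unfolding d' by (subst div_mult_self3) simp_all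
  have db: "bits r d = replicate r 1"
    using bits_repunit[of r "2 * a"] d' by simp
  show pos: "binary d = binary a @ 0 # replicate r 1" if "a > 0"
    using binary_append_bits[of d r] binary_pos[of "2 * a"] that dm db by simp
  have mersenne_iff: "mersenne d \<longleftrightarrow> a = 0"
  proof
    assume "mersenne d"
    then obtain n where "Suc d = 2 ^ n" by (auto simp: mersenne_def)
    then have "2 * a + 1 dvd 2 ^ n" using d by (metis dvd_triv_right)
    moreover have "coprime (2 * a + 1) (2 ^ n)" by simp
    ultimately have "2 * a + 1 = 1" by (metis coprime_absorb_left nat_dvd_1_iff_1)
    then show "a = 0" by simp
  next
    assume "a = 0"
    then show "mersenne d" using d' by (auto simp: mersenne_def)
  qed
  show "padded_binary d = binary a @ 0 # replicate r 1"
  proof (cases "a = 0")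
    case True
    have "binary d = replicate r 1"
    proof (cases r)
      case 0
      then show ?thesis using d' True by simp
    next
      case (Suc q)
      \<comment> \<open>Splitting off the leading 1 makes the part above the low \<open>q\<close>
        digits positive.\<close>
      have d2: "d = 1 * 2 ^ q + (2 ^ q - 1)"
        using d' True Suc one_le_power[of "2::nat" q] by simp
      have "d div 2 ^ q = 1" unfolding d2 by (subst div_mult_self3) simp_all
      moreover have "bits q d = replicate q 1" unfolding d2 by (rule bits_repunit)
      ultimately show ?thesis
        using binary_append_bits[of d q] Suc by (simp add: binary_pos)
    qed
    then show ?thesis using True mersenne_iff by (simp add: padded_binary_def)
  qed (use mersenne_iff pos in \<open>simp add: padded_binary_def\<close>)
qed

lemma swap_rightmost_zero_eq:
  assumes "r > 0"
  shows "swap_rightmost_zero (xs @ 0 # replicate r 1) = xs @ 1 # 0 # replicate (r - 1) 1"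
proof -
  let ?w = "xs @ 0 # replicate r 1"
  have "rightmost_zero ?w = length xs"
    unfolding rightmost_zero_def
    by (rule Max_eqI)
      (auto simp: nth_append nth_Cons split: if_splits nat.splits intro: ccontr)
  moreover obtain q where "r = Suc q" using assms by (cases r) auto
  ultimately show ?thesis
    by (simp add: swap_rightmost_zero_def Let_def list_update_append nth_append)
qed

context
  fixes a r :: nat and w :: "nat list"
  defines "w \<equiv> binary a @ 1 # 0 # replicate (r - 1) 1"
  assumes r: "r \<ge> 2"
begin

text \<open>Makes the set of valleys nonempty, so that its minimum is meaningful.\<close>

lemma valley_swapped: "valley w (Suc (length (binary a)))"
  by (simp add: w_def valley_def nth_append)

lemma valley_le: "valley w i \<Longrightarrow> i \<le> Suc (length (binary a))"
  by (auto simp: w_def valley_def nth_append nth_Cons split: if_splits nat.splits)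

lemma finite_valleys: "finite {height w i | i. valley w i}"
  by (rule finite_surj[of "{..Suc (length (binary a))}" _ "height w"]) (auto dest: valley_le)

text \<open>Behind \<open>A 1\<close> stand one 0 and \<open>r - 1\<close> ones, contributing
  \<open>r - 2\<close>.\<close>

lemma height_swapped:
  "v \<le> Suc (length (binary a)) \<Longrightarrow>
    height w v = balance (drop v (binary a @ [1])) + int r - 2"
  using r by (simp add: w_def height_eq_balance balance_Cons[of _ "_ # _"]
    balance_Cons[of _ "replicate _ _"] balance_replicate drop_Cons' of_nat_diff)

text \<open>A position of minimal height must be a valley: a digit \<open>1\<close> there would be higher than its
  right neighbour, a digit \<open>0\<close> there would be higher than a left neighbour \<open>0\<close>.\<close>

lemma valley_depth_le_height:
  assumes "v \<le> Suc (length (binary a))"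
  shows "valley_depth w \<le> height w v"
proof -
  let ?l = "Suc (length (binary a))"
  obtain i where i: "i \<le> ?l" "\<And>j. j \<le> ?l \<Longrightarrow> height w i \<le> height w j"
    using ex_min_if_finite[of "height w ` {..?l}"] by (auto simp: not_less image_iff)
  have len: "?l < length w" by (simp add: w_def)
  have digits: "w ! j = 0 \<or> w ! j = 1" if "j < length w" for j
  proof -
    have "set w \<subseteq> {0, 1}" using set_binary[of a] by (auto simp: w_def)
    then show ?thesis using that nth_mem by blast
  qed
  have last: "w ! ?l = 0" by (simp add: w_def nth_append)
  \<comment> \<open>Keeps the minimum away from index 0, which has no left neighbour; for
    \<open>a = 0\<close> the leading 1 is the swapped one.\<close>
  have first: "w ! 0 = 1"
    using hd_binary[of a] by (cases "a = 0") (auto simp: w_def nth_append)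
  have zero: "w ! i = 0"
  proof (rule ccontr)
    assume "w ! i \<noteq> 0"
    then have "w ! i = 1" "i < ?l" using digits[of i] i(1) len last by (auto simp: le_less)
    then show False using height_step[of i w] i(2)[of "Suc i"] len by simp
  qed
  with first have pos: "i > 0" by (cases i) auto
  have "w ! (i - 1) = 1"
  proof (rule ccontr)
    assume "w ! (i - 1) \<noteq> 1"
    then have "w ! (i - 1) = 0" using digits[of "i - 1"] i(1) len by simp
    moreover have "i - 1 \<le> ?l" "i - 1 < length w" using i(1) len by linarith+
    ultimately show False using height_step[of "i - 1" w] i(2)[of "i - 1"] pos by simp
  qed
  with zero pos i(1) len have "valley w i" by (simp add: valley_def)
  then have "valley_depth w \<le> height w i"
    unfolding valley_depth_def using finite_valleys by (intro Min_le) auto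
  with i(2)[OF assms] show ?thesis by simp
qed

lemma valley_depth_attained:
  obtains v where "v \<le> Suc (length (binary a))" "height w v = valley_depth w"
proof -
  have "valley_depth w \<in> {height w i | i. valley w i}"
    unfolding valley_depth_def using finite_valleys valley_swapped by (intro Min_in) auto
  then obtain i where "valley w i" "height w i = valley_depth w" by auto
  then show ?thesis using valley_le that by blast
qed

end

section \<open>The Dyck successor\<close>

text \<open>The Dyck condition read inside \<open>A\<close>: the rest \<open>0 1^r\<close> of
  \<open>d\<close> contributes \<open>r - 1\<close>. Beyond \<open>A\<close> the first term
  vanishes.\<close>

lemma dyck_prefix_balance:
  assumes "dyck d" "Suc d = 2 ^ r * (2 * a + 1)" "r > 0"
  shows "0 \<le> balance (drop v (binary a)) + int r - 1"
proof (cases "v < length (binary a)")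
  case True
  then have "a > 0" by (cases a) auto
  then have "binary d = binary a @ 0 # replicate r 1" using padded_binary_eq(2) assms(2) by blast
  then have "balance (drop v (binary d)) = balance (drop v (binary a)) - 1 + int r"
    using True by (simp add: balance_Cons[of _ "replicate _ _"] balance_replicate)
  then show ?thesis using assms(1) unfolding dyck_iff by (metis add.commute add_diff_eq)
qed (use assms(3) in simp)

text \<open>In use the base \<open>(2 * a + 1) * 2 ^ r\<close> is \<open>Suc d\<close>; an offset of
  at most \<open>r\<close> digits leaves \<open>A 1\<close> intact.\<close>

lemma binary_above:
  assumes "b < 2 ^ r"
  shows "binary ((2 * a + 1) * 2 ^ r + b) = binary a @ 1 # bits r b"
proof -
  have "((2 * a + 1) * 2 ^ r + b) div 2 ^ r = 2 * a + 1"
    using assms by (subst div_mult_self3) simp_all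
  then show ?thesis
    using binary_append_bits[of "(2 * a + 1) * 2 ^ r + b" r] binary_double_add_one[of a]
      bits_mult_add[of r "2 * a + 1" b] by simp
qed

lemma bits_zeros_append:
  assumes "b < 2 ^ m" "m \<le> r"
  shows "bits r b = replicate (r - m) 0 @ bits m b"
  using bits_add[of "r - m" m b] assms by (simp add: bits_zero)

text \<open>The string is \<open>A 1 0^(r-m) 1^m\<close>. Suffixes of its tail are nonnegative by
  \<open>r \<le> 2 * m\<close>; those starting earlier gain \<open>1 - (r - m) + m\<close> behind
  \<open>A\<close>, as in the last hypothesis.\<close>

lemma dyck_candidate:
  assumes "m \<le> r" "r \<le> 2 * m"
    and "\<And>v. v \<le> length (binary a) \<Longrightarrow> 0 \<le> balance (drop v (binary a)) + 1 - int r + 2 * int m"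
  shows "dyck ((2 * a + 1) * 2 ^ r + (2 ^ m - 1))"
proof -
  have lt: "2 ^ m - 1 < (2::nat) ^ m" by simp
  moreover have "(2::nat) ^ m \<le> 2 ^ r" using assms(1) by simp
  ultimately have "2 ^ m - 1 < (2::nat) ^ r" by linarith
  with lt have bin: "binary ((2 * a + 1) * 2 ^ r + (2 ^ m - 1))
      = binary a @ 1 # replicate (r - m) 0 @ replicate m 1"
    using binary_above[of "2 ^ m - 1" r a] bits_zeros_append[OF lt assms(1)] bits_repunit[of m 0]
    by simp
  have tail: "0 \<le> balance (drop j (replicate (r - m) 0 @ replicate m 1))" for j
    using assms(1,2) by (simp add: balance_replicate)
  have "0 \<le> balance (drop v (binary a @ 1 # replicate (r - m) 0 @ replicate m 1))" for v
  proof (cases "v \<le> length (binary a)")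
    case True
    then show ?thesis
      using assms(1) assms(3)[OF True]
      by (simp add: balance_Cons[of _ "_ @ _"] balance_replicate of_nat_diff)
  next
    case False
    then obtain j where "v = length (binary a) + Suc j"
      by (metis add_Suc_right less_imp_Suc_add not_le)
    then show ?thesis using tail[of j] by simp
  qed
  then show ?thesis unfolding dyck_iff bin by blast
qed

lemma DS_eqI:
  assumes "dyck e" "d < e" "\<And>y. d < y \<Longrightarrow> y < e \<Longrightarrow> \<not> dyck y"
  shows "DS d = e"
  unfolding DS_def using assms by (intro Least_equality) (auto simp: not_less[symmetric])

lemma DS_long_repunit:
  assumes dyck: "dyck d" and d: "Suc d = 2 ^ r * (2 * a + 1)" and r: "r \<ge> 3"
    and h: "h = valley_depth (swap_rightmost_zero (padded_binary d))"
  shows "0 \<le> h" "h \<le> int r - 2" "DS d = d + 2 ^ (r - 1 - nat (h div 2))"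
proof -
  define w where "w = binary a @ 1 # 0 # replicate (r - 1) 1"
  have h_w: "h = valley_depth w"
    using h r padded_binary_eq(1)[OF d] swap_rightmost_zero_eq[of r "binary a"] by (simp add: w_def)
  have r2: "r \<ge> 2" using r by simp
  have height: "height w v = balance (drop v (binary a @ [1])) + int r - 2"
    if "v \<le> Suc (length (binary a))" for v
    using height_swapped[OF r2 that] by (simp add: w_def)
  have h_le: "h \<le> height w v" if "v \<le> Suc (length (binary a))" for v
    using valley_depth_le_height[OF r2 that] by (simp add: w_def h_w)
  obtain v where v: "v \<le> Suc (length (binary a))" "height w v = h"
    using valley_depth_attained[OF r2, of a] h_w by (auto simp: w_def)
  \<comment> \<open>Swapping preserves the balance of the ending, so heights over \<open>A\<close>
    are those before the swap; the swapped 0 has height \<open>r - 2\<close>.\<close>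
  show h_nonneg: "0 \<le> h"
    using dyck_prefix_balance[OF dyck d, of v] height[OF v(1)] v r
    by (cases "v = Suc (length (binary a))") auto
  show h_upper: "h \<le> int r - 2"
    using h_le[of "Suc (length (binary a))"] height[of "Suc (length (binary a))"] by simp
  define k where "k = nat (h div 2)"
  \<comment> \<open>The candidate ends in \<open>m\<close> ones preceded by
    \<open>r - m = k + 1\<close> zeros.\<close>
  define m where "m = r - 1 - k"
  have k: "2 * int k \<le> h" "h \<le> 2 * int k + 1" using h_nonneg by (auto simp: k_def)
  have mr: "m \<le> r" "r \<le> 2 * m" and m: "int m = int r - 1 - int k"
    using k h_upper by (auto simp: m_def)
  let ?base = "(2 * a + 1) * 2 ^ r"
  have base: "Suc d = ?base" using d by (simp add: mult.commute)
  \<comment> \<open>As \<open>d\<close> is one below the base, adding \<open>2 ^ m\<close> gives the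
    offset \<open>2 ^ m - 1\<close>, that is \<open>m\<close> ones.\<close>
  have e: "d + 2 ^ m = ?base + (2 ^ m - 1)"
    using base one_le_power[of "2::nat" m] by linarith
  have "dyck (d + 2 ^ m)"
    unfolding e
  proof (rule dyck_candidate[OF mr])
    \<comment> \<open>The required quantity is \<open>height w u - 2 * k\<close>, hence at least
      \<open>h - 2 * k\<close>.\<close>
    fix u assume "u \<le> length (binary a)"
    then show "0 \<le> balance (drop u (binary a)) + 1 - int r + 2 * int m"
      using h_le[of u] height[of u] k m by simp
  qed
  moreover have "\<not> dyck y" if y: "d < y" "y < d + 2 ^ m" for y
  proof -
    obtain b where yb: "y = ?base + b"
      using y(1) base by (metis Suc_leI le_Suc_ex)
    then have b: "b < 2 ^ m - 1" using y(2) e by linarith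
    have "b < 2 ^ m" using b by linarith
    moreover have "(2::nat) ^ m \<le> 2 ^ r" using mr(1) by simp
    ultimately have "b < 2 ^ r" by linarith
    with \<open>b < 2 ^ m\<close> have bin: "binary y = (binary a @ [1]) @ replicate (r - m) 0 @ bits m b"
      using binary_above[of b r a] bits_zeros_append[of b m r] mr(1) yb by simp
    have "drop v (binary y) = drop v (binary a @ [1]) @ replicate (r - m) 0 @ bits m b"
      unfolding bin using v(1) by (subst drop_append) simp
    \<comment> \<open>At the deepest position \<open>v\<close> the candidate has height
      \<open>h - 2 * k \<le> 1\<close>; the further 0 in the last \<open>m\<close> digits of
      \<open>y\<close> takes off 2.\<close>
    then have "balance (drop v (binary y)) \<le>
        balance (drop v (binary a @ [1])) - int (r - m) + (int m - 2)"
      using balance_bits_le[OF b] by (simp add: balance_replicate del: drop_append)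
    also have "\<dots> = h - 2 * int k - 2"
      using height[OF v(1)] v(2) m mr(1) by (simp add: of_nat_diff)
    also have "\<dots> < 0" using k by simp
    finally show ?thesis unfolding dyck_iff by (metis not_le)
  qed
  ultimately show "DS d = d + 2 ^ (r - 1 - nat (h div 2))"
    by (intro DS_eqI) (simp_all add: m_def k_def)
qed

text \<open>Only the even number \<open>d + 1\<close> lies between, and \<open>d + 2\<close> is the
  candidate with \<open>m = 1\<close>.\<close>

lemma DS_short_repunit:
  assumes dyck: "dyck d" and d: "Suc d = 2 ^ r * (2 * a + 1)" and r: "r = 1 \<or> r = 2"
  shows "DS d = d + 2"
proof (rule DS_eqI)
  have "d + 2 = (2 * a + 1) * 2 ^ r + (2 ^ 1 - 1)"
    using d by (simp add: mult.commute)
  moreover have "dyck \<dots>"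
  proof (rule dyck_candidate)
    fix v
    \<comment> \<open>The balance is at least \<open>1 - r\<close>, and
      \<open>(1 - r) + (3 - r) \<ge> 0\<close> because \<open>r \<le> 2\<close>.\<close>
    show "0 \<le> balance (drop v (binary a)) + 1 - int r + 2 * int 1"
      using dyck_prefix_balance[OF dyck d, of v] r by auto
  qed (use r in auto)
  ultimately show "dyck (d + 2)" by simp
next
  fix y assume y: "d < y" "y < d + 2"
  then have "y = 2 ^ r * (2 * a + 1)" using d by simp
  then have "even y" using r by auto
  then show "\<not> dyck y" using not_dyck_even[of y] y by simp
qed simp

theorem theorem9:
  fixes d r :: nat and h :: int
  assumes "dyck d"
    and "r = repunit_length d"
    and "h = valley_depth (swap_rightmost_zero (padded_binary d))"
  shows "(r = 0 \<longrightarrow> DS d = 1) \<and>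
    (r = 1 \<or> r = 2 \<longrightarrow> DS d = d + 2) \<and>
    (r \<ge> 3 \<longrightarrow> real (DS d) = real d + 2 powi (int r - 1 - \<lfloor>real_of_int h / 2\<rfloor>))"
proof -
  obtain a where d: "Suc d = 2 ^ r * (2 * a + 1)"
    using Suc_eq_repunit_length[of d] assms(2) by auto
  have "DS d = 1" if "r = 0"
  proof -
    \<comment> \<open>Here \<open>Suc d\<close> is odd, and 0 is the only even Dyck number.\<close>
    have "d = 0" using d that not_dyck_even[of d] assms(1) by auto
    have "dyck 1" unfolding dyck_iff by (simp add: binary_pos drop_Cons')
    then show ?thesis unfolding \<open>d = 0\<close> by (intro DS_eqI) auto
  qed
  moreover have "DS d = d + 2" if "r = 1 \<or> r = 2"
    using DS_short_repunit[OF assms(1) d that] .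
  moreover have "real (DS d) = real d + 2 powi (int r - 1 - \<lfloor>real_of_int h / 2\<rfloor>)" if "r \<ge> 3"
  proof -
    note long = DS_long_repunit[OF assms(1) d that assms(3)]
    have "\<lfloor>real_of_int h / 2\<rfloor> = h div 2"
      using floor_divide_of_int_eq[of h 2] by simp
    \<comment> \<open>The bounds on \<open>h\<close> rule out truncation, so the integer exponent is
      a natural number.\<close>
    moreover have "int r - 1 - h div 2 = int (r - 1 - nat (h div 2))"
      using long(1,2) that by (simp add: of_nat_diff nat_le_iff)
    ultimately show ?thesis using long(3) by (simp add: power_int_of_nat)
  qed
  ultimately show ?thesis by blast
qed

end
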